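(* As $\beta\to\infty$ the quality factors of the high-loss eigenvalues of $A(\beta)$ are (for $\beta$ sufficiently large) decreasing functions of $\beta$ with $$Q_{\zeta_j(\beta)}\searrow0,\qquad 1\le j\le N_R .$$ If $\operatorname{Ker}R\cap\operatorname{Ker}\eta=\{0\}$, then, with the low-loss eigenvalues indexed so that $\rho_j=0$ for $N_R+1\le j\le 2N_R$ and $\rho_j\ne0$ for $2N_R+1\le j\le 2N$, as $\beta\to\infty$ the quality factors $Q_{\zeta_j(\beta)}$ are (for $\beta$ sufficiently large) either decreasing or increasing functions of $\beta$ and, in particular, $$Q_{\zeta_j(\beta)}\searrow0,\quad N_R+1\le j\le 2N_R;\qquad Q_{\zeta_j(\beta)}\nearrow+\infty,\quad 2N_R+1\le j\le 2N .$$
   Context: Setting. $N\ge 1$; $\alpha,\eta,\theta,R$ are real $N\times N$ matrices with $\alpha^{\mathrm T}=\alpha>0$, $\eta^{\mathrm T}=\eta\ge0$, $\theta^{\mathrm T}=-\theta$, $R^{\mathrm T}=R\ge0$, and $N_R=\operatorname{rank}R>0$; $\beta\ge0$. $\sqrt{\cdot}$ denotes the positive semidefinite square root. On $H=\mathbb C^{2N}=\mathbb C^N\oplus\mathbb C^N$ (standard inner product) set $$\Omega=\begin{bmatrix}-2\mathrm i\sqrt\alpha^{-1}\theta\sqrt\alpha^{-1} & -\mathrm i\Phi^{\mathrm T}\\ \mathrm i\Phi&0\end{bmatrix},\quad \Phi=\sqrt\eta\sqrt\alpha^{-1},\quad B=\begin{bmatrix}\sqrt\alpha^{-1}R\sqrt\alpha^{-1}&0\\0&0\end{bmatrix},\quad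 A(\beta)=\Omega-\mathrm i\beta B .$$ $\Omega$ is Hermitian, $B\ge0$, $\operatorname{rank}B=N_R$; all eigenvalues $\zeta$ of $A(\beta)$ satisfy $\operatorname{Im}\zeta\le0$. The quality factor is $Q_\zeta=\frac12\frac{|\operatorname{Re}\zeta|}{-\operatorname{Im}\zeta}$, with $Q_\zeta=+\infty$ if $\operatorname{Im}\zeta=0\neq\operatorname{Re}\zeta$ and $Q_0=0$. "Decreasing/increasing" is meant in the non-strict sense (functions identically $0$ or identically $+\infty$ are allowed). High-loss and low-loss eigenvalues (known facts). Let $0<b_1\le\dots\le b_{N_R}$ be the nonzero eigenvalues of $B$ with multiplicity, $P_B^\perp$ the orthogonal projection onto $\operatorname{Ker}B$, $P_B=\mathbf 1-P_B^\perp$, $\Omega_1=P_B^\perp\Omega P_B^\perp|_{\operatorname{Ker}B}$, $\Theta=P_B\Omega P_B^\perp|_{\operatorname{Ker}B}:\operatorname{Ker}B\to\operatorname{Ran}B$, $B_2=B|_{\operatorname{Ran}B}$. There is an orthonormal basis $\{\mathring w_j\}_{j=1}^{2N}$ of $H$ with $B\mathring w_j=b_j\mathring w_j$ for $1\le j\le N_R$ and $\mathring w_j\in\operatorname{Ker}B$, $\Omega_1\mathring w_j=\rho_j\mathring w_j$ for $N_R+1\le j\le 2N$, such that for all sufficiently large $\beta$ the operator $A(\beta)$ has a basis of eigenvectors $w_j(\beta)$ with eigenvalues $\zeta_j(\beta)$, where $w_j(\beta)=\mathring w_j+O(\beta^{-1})$ is a convergent power series in $\beta^{-1}$, and: (high-loss,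 $1\le j\le N_R$) $\zeta_j(\beta)=-\mathrm i b_j\beta+\rho_j+O(\beta^{-1})$ is a convergent Laurent series in $\beta^{-1}$, $\rho_j=(\mathring w_j,\Omega\mathring w_j)$; (low-loss, $N_R+1\le j\le 2N$) $\zeta_j(\beta)=\rho_j-\mathrm i d_j\beta^{-1}+O(\beta^{-2})$ is a convergent power series in $\beta^{-1}$, $d_j=(\mathring w_j,\Theta^*B_2^{-1}\Theta\mathring w_j)\ge0$. Moreover the series of $\operatorname{Re}\zeta_j(\beta)$ contains only even powers of $\beta^{-1}$, and $\operatorname{Im}\zeta_j(\beta)$ contains only odd powers or vanishes identically. If $\operatorname{Ker}R\cap\operatorname{Ker}\eta=\{0\}$, then exactly $N_R$ of the $\rho_j$, $N_R+1\le j\le2N$, are zero. *)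

theory Defs
  imports "HOL-Analysis.Analysis"
begin

definition pos_semidef :: "real^'n^'n \<Rightarrow> bool" where
  "pos_semidef M \<longleftrightarrow> transpose M = M \<and> (\<forall>x. 0 \<le> x \<bullet> (M *v x))"

definition pos_def :: "real^'n^'n \<Rightarrow> bool" where
  "pos_def M \<longleftrightarrow> transpose M = M \<and> (\<forall>x. x \<noteq> 0 \<longrightarrow> 0 < x \<bullet> (M *v x))"

definition psd_sqrt :: "real^'n^'n \<Rightarrow> real^'n^'n" where
  "psd_sqrt M = (THE S. pos_semidef S \<and> S ** S = M)"

definition block_matrix ::
  "'a^'n^'n \<Rightarrow> 'a^'n^'n \<Rightarrow> 'a^'n^'n \<Rightarrow> 'a^'n^'n \<Rightarrow> 'a^('n + 'n)^('n + 'n)" where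
  "block_matrix M11 M12 M21 M22 = (\<chi> i j. case i of
       Inl k \<Rightarrow> (case j of Inl l \<Rightarrow> M11 $ k $ l | Inr l \<Rightarrow> M12 $ k $ l)
     | Inr k \<Rightarrow> (case j of Inl l \<Rightarrow> M21 $ k $ l | Inr l \<Rightarrow> M22 $ k $ l))"

definition Phi_mat :: "real^'n^'n \<Rightarrow> real^'n^'n \<Rightarrow> real^'n^'n" where
  "Phi_mat \<alpha> \<eta> = psd_sqrt \<eta> ** matrix_inv (psd_sqrt \<alpha>)"

definition Omega_mat ::
  "real^'n^'n \<Rightarrow> real^'n^'n \<Rightarrow> real^'n^'n \<Rightarrow> complex^('n + 'n)^('n + 'n)" where
  "Omega_mat \<alpha> \<eta> \<theta> = block_matrix
     (map_matrix (\<lambda>x. - 2 * \<i> * complex_of_real x)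
        (matrix_inv (psd_sqrt \<alpha>) ** \<theta> ** matrix_inv (psd_sqrt \<alpha>)))
     (map_matrix (\<lambda>x. - \<i> * complex_of_real x) (transpose (Phi_mat \<alpha> \<eta>)))
     (map_matrix (\<lambda>x. \<i> * complex_of_real x) (Phi_mat \<alpha> \<eta>))
     0"

definition B_mat :: "real^'n^'n \<Rightarrow> real^'n^'n \<Rightarrow> complex^('n + 'n)^('n + 'n)" where
  "B_mat \<alpha> R = block_matrix
     (map_matrix complex_of_real
        (matrix_inv (psd_sqrt \<alpha>) ** R ** matrix_inv (psd_sqrt \<alpha>)))
     0 0 0"

definition A_mat :: "real^'n^'n \<Rightarrow> real^'n^'n \<Rightarrow> real^'n^'n \<Rightarrow> real^'n^'n \<Rightarrow> real
    \<Rightarrow> complex^('n + 'n)^('n + 'n)" where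
  "A_mat \<alpha> \<eta> \<theta> R \<beta> =
     Omega_mat \<alpha> \<eta> \<theta> - map_matrix (\<lambda>z. \<i> * complex_of_real \<beta> * z) (B_mat \<alpha> R)"

text \<open>The Hermitian inner product, antilinear in the first argument. The library's
  \<open>\<bullet>\<close> on complex vectors is only its real part.\<close>

definition cdot :: "complex^'m \<Rightarrow> complex^'m \<Rightarrow> complex" where
  "cdot x y = (\<Sum>i\<in>UNIV. cnj (x $ i) * y $ i)"

definition orth_proj :: "(complex^'m) set \<Rightarrow> complex^'m \<Rightarrow> complex^'m" where
  "orth_proj S x = (THE y. y \<in> S \<and> (\<forall>z\<in>S. cdot z (x - y) = 0))"

definition Omega1 :: "real^'n^'n \<Rightarrow> real^'n^'n \<Rightarrow> real^'n^'n \<Rightarrow> real^'n^'n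
    \<Rightarrow> complex^('n + 'n) \<Rightarrow> complex^('n + 'n)" where
  "Omega1 \<alpha> \<eta> \<theta> R x =
     (let P = orth_proj {y. B_mat \<alpha> R *v y = 0} in P (Omega_mat \<alpha> \<eta> \<theta> *v P x))"

text \<open>The data of the high-loss (\<open>1 \<le> j \<le> rank R\<close>) and low-loss
  (\<open>rank R < j \<le> 2 N\<close>) eigenvalues. Here \<open>w0 j\<close> are the unperturbed eigenvectors, and
  \<open>w j \<beta>\<close>, \<open>\<zeta> j \<beta>\<close> the eigenvectors and eigenvalues of the matrix at \<open>\<beta>\<close>, constrained for
  large \<open>\<beta>\<close> only. Since the orthonormal family \<open>w0\<close> diagonalises \<open>B_mat\<close>, the numbers
  \<open>b 1, \<dots>, b (rank R)\<close> are automatically its nonzero eigenvalues with multiplicity. The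
  coefficient of \<open>1/\<beta>\<close> in the low-loss series and the parity of the powers occurring in
  \<open>Re\<close> and \<open>Im\<close> are consequences of these conditions, so they are not imposed.\<close>

definition loss_eigensystem :: "real^'n^'n \<Rightarrow> real^'n^'n \<Rightarrow> real^'n^'n \<Rightarrow> real^'n^'n
    \<Rightarrow> (nat \<Rightarrow> real) \<Rightarrow> (nat \<Rightarrow> real) \<Rightarrow> (nat \<Rightarrow> complex^('n + 'n))
    \<Rightarrow> (nat \<Rightarrow> real \<Rightarrow> complex^('n + 'n)) \<Rightarrow> (nat \<Rightarrow> real \<Rightarrow> complex) \<Rightarrow> bool" where
  "loss_eigensystem \<alpha> \<eta> \<theta> R b \<rho> w0 w \<zeta> \<longleftrightarrow>
     (let N = CARD('n); NR = rank R in
      (\<forall>i\<in>{1..2*N}. \<forall>j\<in>{1..2*N}. cdot (w0 i) (w0 j) = (if i = j then 1 else 0)) \<and>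
      mono_on {1..NR} b \<and>
      (\<forall>j\<in>{1..NR}. 0 < b j \<and>
         B_mat \<alpha> R *v w0 j = complex_of_real (b j) *s w0 j \<and>
         complex_of_real (\<rho> j) = cdot (w0 j) (Omega_mat \<alpha> \<eta> \<theta> *v w0 j)) \<and>
      (\<forall>j\<in>{NR+1..2*N}.
         B_mat \<alpha> R *v w0 j = 0 \<and>
         Omega1 \<alpha> \<eta> \<theta> R (w0 j) = complex_of_real (\<rho> j) *s w0 j) \<and>
      (\<forall>\<^sub>F \<beta> in at_top.
         (\<forall>j\<in>{1..2*N}. A_mat \<alpha> \<eta> \<theta> R \<beta> *v w j \<beta> = \<zeta> j \<beta> *s w j \<beta>) \<and>
         inj_on (\<lambda>j. w j \<beta>) {1..2*N} \<and>
         vec.independent ((\<lambda>j. w j \<beta>) ` {1..2*N}) \<and>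
         vec.span ((\<lambda>j. w j \<beta>) ` {1..2*N}) = UNIV) \<and>
      (\<forall>j\<in>{1..2*N}. \<exists>c. c 0 = w0 j \<and>
         (\<forall>\<^sub>F \<beta> in at_top. (\<lambda>k. (1 / \<beta>) ^ k *\<^sub>R c k) sums w j \<beta>)) \<and>
      (\<forall>j\<in>{1..NR}. \<exists>a. a 0 = - \<i> * complex_of_real (b j) \<and> a 1 = complex_of_real (\<rho> j) \<and>
         (\<forall>\<^sub>F \<beta> in at_top. (\<lambda>k. a k * complex_of_real (\<beta> powi (1 - int k))) sums \<zeta> j \<beta>)) \<and>
      (\<forall>j\<in>{NR+1..2*N}. \<exists>a. a 0 = complex_of_real (\<rho> j) \<and>
         (\<forall>\<^sub>F \<beta> in at_top. (\<lambda>k. a k * complex_of_real ((1 / \<beta>) ^ k)) sums \<zeta> j \<beta>)))"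

definition quality_factor :: "complex \<Rightarrow> ereal" where
  "quality_factor z =
     (if z = 0 then 0
      else if Im z = 0 then \<infinity>
      else ereal (1/2 * (\<bar>Re z\<bar> / - Im z)))"

definition eventually_decreases_to :: "(real \<Rightarrow> ereal) \<Rightarrow> ereal \<Rightarrow> bool" where
  "eventually_decreases_to f L \<longleftrightarrow> (\<exists>\<beta>0. antimono_on {\<beta>0..} f) \<and> (f \<longlongrightarrow> L) at_top"

definition eventually_increases_to :: "(real \<Rightarrow> ereal) \<Rightarrow> ereal \<Rightarrow> bool" where
  "eventually_increases_to f L \<longleftrightarrow> (\<exists>\<beta>0. mono_on {\<beta>0..} f) \<and> (f \<longlongrightarrow> L) at_top"

end

theory Submission
  imports Defs
begin

text \<open>After multiplication by a positive factor, which leaves the quality factor unchanged, an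
  eigenvalue is a convergent power series in \<open>x = 1/\<beta>\<close>, so \<open>Q\<close> or \<open>1/Q\<close> is the absolute value of a
  quotient \<open>h\<close> of real power series with \<open>h 0 = 0\<close>. The numerator of \<open>h'\<close> is again a power
  series, so it vanishes identically or has no zeros in some interval \<open>(0, \<epsilon>)\<close>; hence \<open>\<bar>h\<bar>\<close> is
  increasing in \<open>x\<close> near \<open>0\<close>.

  This applies with the factor \<open>1/\<beta>\<close> to high-loss eigenvalues, whose leading coefficient is
  \<open>- \<i> b\<^sub>j\<close>, and with the factor \<open>1\<close> and the roles of \<open>Re\<close> and \<open>Im\<close> exchanged to low-loss ones with
  \<open>\<rho>\<^sub>j \<noteq> 0\<close>. If \<open>\<rho>\<^sub>j = 0\<close>, then either \<open>\<zeta>\<^sub>j = 0\<close> for large \<open>\<beta>\<close> or \<open>\<beta> \<zeta>\<^sub>j\<close> has leading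
  coefficient \<open>- \<i> d\<close> with \<open>d > 0\<close>, as for the high-loss ones.\<close>

subsection \<open>Square roots of positive semidefinite matrices\<close>

text \<open>A maximiser \<open>v\<close> of the quadratic form on the unit sphere of
  \<open>V\<close> is an eigenvector, and by symmetry its orthogonal complement in \<open>V\<close>
  is again invariant. Working with invariant subspaces makes this an induction on the
  dimension.\<close>

lemma symmetric_linear_orthonormal_eigenbasis:
  fixes f :: "'a::euclidean_space \<Rightarrow> 'a"
  assumes lin: "linear f" and sym: "\<And>x y. f x \<bullet> y = x \<bullet> f y"
    and V: "subspace V" and inv: "\<And>x. x \<in> V \<Longrightarrow> f x \<in> V"
  shows "\<exists>B \<subseteq> V. pairwise orthogonal B \<and> (\<forall>b\<in>B. norm b = 1 \<and> (\<exists>l. f b = l *\<^sub>R b)) \<and> span B = V"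
  using V inv
proof (induction "dim V" arbitrary: V rule: less_induct)
  case less
  show ?case
  proof (cases "V = {0}")
    case True
    then show ?thesis by (intro exI[of _ "{}"]) (auto simp: pairwise_def)
  next
    case False
    let ?S = "V \<inter> sphere 0 1"
    obtain u where u: "u \<in> V" "u \<noteq> 0"
      using False subspace_0[OF less.prems(1)] by blast
    then have "(1 / norm u) *\<^sub>R u \<in> ?S"
      using less.prems(1) by (auto simp: subspace_scale)
    moreover have "compact ?S"
      using closed_subspace[OF less.prems(1)] by (simp add: compact_sphere closed_Int_compact)
    moreover have "continuous_on ?S (\<lambda>x. x \<bullet> f x)"
      by (intro continuous_intros linear_continuous_on linear_conv_bounded_linear[THEN iffD1] lin)
    ultimately obtain v where v: "v \<in> V" "norm v = 1" 
      and max: "\<And>y. y \<in> ?S \<Longrightarrow> y \<bullet> f y \<le> v \<bullet> f v"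
      using continuous_attains_sup[of ?S "\<lambda>x. x \<bullet> f x"] by (metis IntD1 IntD2 dist_0_norm empty_iff mem_sphere)
    define l where "l = v \<bullet> f v"
    \<comment> \<open>By maximality of \<open>l\<close> the form of \<open>g\<close> is nonnegative
      on \<open>V\<close> and vanishes at \<open>v\<close>; as for any semidefinite form, this
      forces \<open>g v = 0\<close>.\<close>
    define g where "g x = l *\<^sub>R x - f x" for x
    have ling: "linear g"
      unfolding g_def by (intro linear_compose_sub lin linear_scaleR)
    have g_nonneg: "0 \<le> x \<bullet> g x" if "x \<in> V" for x
    proof (cases "x = 0")
      case False
      have "(1 / norm x) *\<^sub>R x \<in> ?S"
        using False less.prems(1) that by (auto simp: subspace_scale)
      from max[OF this] show ?thesis
        using False by (simp add: g_def l_def linear_scale[OF lin] inner_diff_right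
            divide_simps power2_norm_eq_inner[symmetric] power2_eq_square)
    qed (simp add: g_def)
    have gv: "v \<bullet> g v = 0"
      using v by (simp add: g_def l_def inner_diff_right power2_norm_eq_inner[symmetric])
    have gV: "g x \<in> V" if "x \<in> V" for x
      unfolding g_def using that less.prems by (intro subspace_diff subspace_scale) auto
    have gsym: "g x \<bullet> y = x \<bullet> g y" for x y
      by (simp add: g_def inner_diff_left inner_diff_right sym)
    have "g v = 0"
    proof (rule ccontr)
      assume nz: "g v \<noteq> 0"
      define c where "c = g v \<bullet> g v"
      define d where "d = g v \<bullet> g (g v)"
      have c: "c > 0" using nz by (simp add: c_def)
      have d: "d \<ge> 0" unfolding d_def by (intro g_nonneg gV v)
      have quad: "0 \<le> d * t\<^sup>2 - 2 * t * c" for t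
      proof -
        have "0 \<le> (v - t *\<^sub>R g v) \<bullet> g (v - t *\<^sub>R g v)"
          using less.prems(1) by (intro g_nonneg subspace_diff subspace_scale gV v)
        also have "\<dots> = d * t\<^sup>2 - 2 * t * c"
          using gv gsym[of v "g v"]
          by (simp add: linear_diff[OF ling] linear_scale[OF ling] inner_diff_left inner_diff_right
              c_def d_def power2_eq_square algebra_simps)
        finally show ?thesis .
      qed
      \<comment> \<open>The polynomial \<open>d * t\<^sup>2 - 2 * t * c\<close> is negative for
        small \<open>t > 0\<close>; the \<open>+ 1\<close> keeps this choice of \<open>t\<close>
        meaningful when \<open>d = 0\<close>.\<close>
      have "c / (d + 1) > 0" using c d by simp
      moreover have "d * (c / (d + 1)) < 2 * c"
      proof -
        have "d * (c / (d + 1)) \<le> c" using c d by (simp add: divide_simps algebra_simps)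
        with c show ?thesis by linarith
      qed
      ultimately have "c / (d + 1) * (d * (c / (d + 1)) - 2 * c) < 0"
        by (intro mult_pos_neg) auto
      with quad[of "c / (d + 1)"] show False
        by (simp add: algebra_simps power2_eq_square)
    qed
    then have fv: "f v = l *\<^sub>R v" by (simp add: g_def)
    define W where "W = {x \<in> V. x \<bullet> v = 0}"
    have "subspace W"
      using less.prems(1) by (auto simp: W_def subspace_def inner_add_left)
    moreover have "f x \<in> W" if "x \<in> W" for x
      using that less.prems(2) by (simp add: W_def sym fv)
    moreover have "dim W < dim V"
    proof -
      have "v \<notin> W" using v unfolding W_def by (auto simp: norm_eq_1)
      then have "W \<subset> V" using v(1) unfolding W_def by blast
      then show ?thesis
        using \<open>subspace W\<close> less.prems(1) by (intro dim_psubset) (simp add: span_eq_iff[THEN iffD2])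
    qed
    ultimately obtain B where B: "B \<subseteq> W" "pairwise orthogonal B"
      "\<And>b. b \<in> B \<Longrightarrow> norm b = 1 \<and> (\<exists>l. f b = l *\<^sub>R b)" "span B = W"
      using less.hyps[of W] by blast
    have "span (insert v B) = V"
    proof
      show "span (insert v B) \<subseteq> V"
        using B(1) v less.prems(1) by (intro span_minimal) (auto simp: W_def)
      show "V \<subseteq> span (insert v B)"
      proof
        fix x assume "x \<in> V"
        then have "x - (x \<bullet> v) *\<^sub>R v \<in> W"
          using v less.prems(1)
          by (auto simp: W_def subspace_diff subspace_scale inner_diff_left power2_norm_eq_inner[symmetric])
        then show "x \<in> span (insert v B)"
          unfolding span_insert using B(4) by blast
      qed
    qed
    moreover have "pairwise orthogonal (insert v B)"
      using B(1,2) by (auto simp: pairwise_insert W_def orthogonal_def inner_commute)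
    ultimately show ?thesis
      using B v fv by (intro exI[of _ "insert v B"]) (auto simp: W_def)
  qed
qed

lemma inner_matrix_symmetric:
  fixes M :: "real^'n^'n"
  assumes "transpose M = M"
  shows "(M *v x) \<bullet> y = x \<bullet> (M *v y)"
  by (metis assms dot_lmul_matrix transpose_matrix_vector)

lemma symmetric_matrix_orthonormal_eigenbasis:
  fixes M :: "real^'n^'n"
  assumes "transpose M = M"
  obtains B l where "pairwise orthogonal B" "\<And>b. b \<in> B \<Longrightarrow> norm b = 1"
    "\<And>b. b \<in> B \<Longrightarrow> M *v b = l b *\<^sub>R b" "span B = UNIV"
proof -
  have "\<exists>B \<subseteq> UNIV. pairwise orthogonal B \<and> (\<forall>b\<in>B. norm b = 1 \<and> (\<exists>l. M *v b = l *\<^sub>R b)) \<and> span B = UNIV"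
    by (rule symmetric_linear_orthonormal_eigenbasis) (auto simp: inner_matrix_symmetric[OF assms])
  then obtain B where B: "pairwise orthogonal B" "span B = UNIV"
    "\<And>b. b \<in> B \<Longrightarrow> norm b = 1" "\<forall>b\<in>B. \<exists>l. M *v b = l *\<^sub>R b" by blast
  from bchoice[OF B(4)] obtain l where "\<forall>b\<in>B. M *v b = l b *\<^sub>R b" ..
  with B that show ?thesis by blast
qed

text \<open>On an orthonormal eigenbasis the root multiplies \<open>b\<close> by
  \<open>sqrt (l b)\<close>. Written through the coordinates \<open>x \<bullet> b\<close>, it is an
  explicit linear map whose symmetry and nonnegativity can be read off.\<close>

lemma psd_sqrt_exists:
  assumes "pos_semidef M"
  shows "\<exists>S. pos_semidef S \<and> S ** S = M"
proof -
  have sym: "transpose M = M" and nonneg: "\<And>x. 0 \<le> x \<bullet> (M *v x)"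
    using assms by (auto simp: pos_semidef_def)
  obtain B l where orth: "pairwise orthogonal B" and norm: "\<And>b. b \<in> B \<Longrightarrow> norm b = 1"
    and l: "\<And>b. b \<in> B \<Longrightarrow> M *v b = l b *\<^sub>R b" and span: "span B = UNIV"
    using symmetric_matrix_orthonormal_eigenbasis[OF sym] by metis
  have "0 \<notin> B" using norm by fastforce
  then have fin: "finite B"
    using orth by (intro independent_imp_finite pairwise_orthogonal_independent)
  define s where "s x = (\<Sum>b\<in>B. (sqrt (l b) * (x \<bullet> b)) *\<^sub>R b)" for x
  have lin: "linear s"
    unfolding s_def
    by (intro linear_compose_sum ballI linearI) (auto simp: inner_add_left algebra_simps)
  have l0: "0 \<le> l b" if "b \<in> B" for b
    using nonneg[of b] norm[OF that] l[OF that] by (simp add: power2_norm_eq_inner[symmetric])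
  have sb: "s b = sqrt (l b) *\<^sub>R b" if "b \<in> B" for b
  proof -
    have "s b = (\<Sum>c\<in>B. if c = b then sqrt (l b) *\<^sub>R b else 0)"
      unfolding s_def
    proof (intro sum.cong refl)
      fix c assume "c \<in> B"
      with that orth norm[OF that] show "(sqrt (l c) * (b \<bullet> c)) *\<^sub>R c = (if c = b then sqrt (l b) *\<^sub>R b else 0)"
        by (auto simp: pairwise_def orthogonal_def power2_norm_eq_inner[symmetric])
    qed
    with that fin show ?thesis by simp
  qed
  have "M *v x = s (s x)" for x
  proof (rule linear_eq_on[of "(*v) M" "\<lambda>x. s (s x)" x B])
    show "linear (\<lambda>x. s (s x))" using linear_compose[OF lin lin] by (simp add: o_def)
    show "M *v b = s (s b)" if "b \<in> B" for b
      using l[OF that] l0[OF that] by (simp add: sb that linear_scale[OF lin])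
  qed (auto simp: span)
  moreover have ms: "matrix s *v x = s x" for x
    using matrix_vector_mul(2)[OF lin] by metis
  ultimately have "matrix s ** matrix s = M"
    by (simp add: matrix_eq matrix_vector_mul_assoc[symmetric])
  moreover have s_sym: "x \<bullet> s y = s x \<bullet> y" for x y
    by (simp add: s_def inner_sum_left inner_sum_right inner_commute algebra_simps)
  have "transpose (matrix s) = matrix s"
  proof (subst matrix_eq, rule allI, rule vector_eq_ldot[THEN iffD1], rule allI)
    fix x z
    have "z \<bullet> (transpose (matrix s) *v x) = (matrix s *v z) \<bullet> x"
      by (simp add: transpose_matrix_vector inner_commute[of z] inner_commute[of _ x] dot_lmul_matrix)
    then show "z \<bullet> (transpose (matrix s) *v x) = z \<bullet> (matrix s *v x)"
      by (simp add: ms s_sym)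
  qed
  moreover have "0 \<le> x \<bullet> s x" for x
    unfolding s_def inner_sum_right
    by (intro sum_nonneg) (auto simp: l0 inner_commute mult.assoc)
  ultimately show ?thesis
    by (intro exI[of _ "matrix s"]) (auto simp: pos_semidef_def ms)
qed

text \<open>On an eigenvector \<open>b\<close> of \<open>S\<close>, the equation
  \<open>T (T b) = (l b)^2 b\<close> factors as \<open>(T + l b) (T - l b) b = 0\<close>. It
  suffices to compare \<open>S\<close> and \<open>T\<close> on an eigenbasis of
  \<open>S\<close>.\<close>

lemma psd_sqrt_unique:
  assumes S: "pos_semidef S" and T: "pos_semidef T" and eq: "S ** S = T ** T"
  shows "S = T"
proof -
  have symS: "transpose S = S" and symT: "transpose T = T"
    using S T by (auto simp: pos_semidef_def)
  obtain B l where norm: "\<And>b. b \<in> B \<Longrightarrow> norm b = 1"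
    and l: "\<And>b. b \<in> B \<Longrightarrow> S *v b = l b *\<^sub>R b" and span: "span B = UNIV"
    using symmetric_matrix_orthonormal_eigenbasis[OF symS] by metis
  have "S *v b = T *v b" if b: "b \<in> B" for b
  proof -
    have l0: "0 \<le> l b"
      using S norm[OF b] l[OF b] unfolding pos_semidef_def
      by (metis inner_scaleR_right mult.right_neutral norm_eq_1)
    \<comment> \<open>Unless it vanishes, \<open>u\<close> is an eigenvector of \<open>T\<close> for
      \<open>- l b\<close>. If \<open>l b > 0\<close>, this contradicts nonnegativity of
      \<open>T\<close>; if \<open>l b = 0\<close>, then \<open>u = T b\<close> has squared norm
      \<open>b \<bullet> T (T b) = 0\<close>.\<close>
    define u where "u = T *v b - l b *\<^sub>R b"
    have TT: "T *v (T *v b) = (l b * l b) *\<^sub>R b"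
      by (metis eq l[OF b] matrix_vector_mul_assoc matrix_vector_mult_scaleR scaleR_scaleR)
    have Tu: "T *v u = - l b *\<^sub>R u"
      by (simp add: u_def matrix_vector_mult_diff_distrib matrix_vector_mult_scaleR TT algebra_simps)
    have "u = 0"
    proof (cases "l b = 0")
      case True
      have "u \<bullet> u = b \<bullet> (T *v (T *v b))"
        using True inner_matrix_symmetric[OF symT, of b "T *v b"] by (simp add: u_def)
      with True TT show ?thesis by simp
    next
      case False
      have "0 \<le> u \<bullet> (T *v u)" using T by (simp add: pos_semidef_def)
      with Tu False l0 have "u \<bullet> u \<le> 0" by (simp add: mult_le_0_iff)
      then show ?thesis by (metis inner_eq_zero_iff inner_ge_zero order_antisym)
    qed
    then show ?thesis by (simp add: u_def l[OF b])
  qed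
  then have "S *v x = T *v x" for x
    by (intro linear_eq_on[of "(*v) S" "(*v) T" x B]) (auto simp: span)
  then show ?thesis by (simp add: matrix_eq)
qed

lemma psd_sqrt_works:
  assumes "pos_semidef M"
  shows "pos_semidef (psd_sqrt M)" "psd_sqrt M ** psd_sqrt M = M"
proof -
  have "\<exists>!S. pos_semidef S \<and> S ** S = M"
    using psd_sqrt_exists[OF assms] psd_sqrt_unique by metis
  from theI'[OF this] show "pos_semidef (psd_sqrt M)" "psd_sqrt M ** psd_sqrt M = M"
    by (auto simp: psd_sqrt_def)
qed

text \<open>Positive definiteness makes \<open>psd_sqrt \<alpha>\<close> injective, hence
  invertible; this ensures that the choice in \<open>matrix_inv\<close> yields a genuine inverse,
  and uniqueness of inverses then transfers the symmetry.\<close>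

lemma transpose_inverse_psd_sqrt:
  fixes \<alpha> :: "real^'n^'n"
  assumes "pos_def \<alpha>"
  shows "transpose (matrix_inv (psd_sqrt \<alpha>)) = matrix_inv (psd_sqrt \<alpha>)"
proof -
  let ?S = "psd_sqrt \<alpha>"
  have "pos_semidef \<alpha>"
    using assms unfolding pos_semidef_def pos_def_def by (metis inner_zero_left order.refl order_less_imp_le)
  from psd_sqrt_works[OF this] have S: "transpose ?S = ?S" "?S ** ?S = \<alpha>"
    by (auto simp: pos_semidef_def)
  have "x = 0" if "?S *v x = 0" for x
  proof -
    have "\<alpha> *v x = ?S *v (?S *v x)" by (simp add: matrix_vector_mul_assoc S(2))
    with that have "x \<bullet> (\<alpha> *v x) = 0" by simp
    with assms show ?thesis unfolding pos_def_def by force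
  qed
  then have "invertible ?S"
    unfolding invertible_left_inverse matrix_left_invertible_ker by blast
  then have inv: "?S ** matrix_inv ?S = mat 1" "matrix_inv ?S ** ?S = mat 1"
    unfolding invertible_def matrix_inv_def by (metis (mono_tags, lifting) someI_ex)+
  have "transpose (matrix_inv ?S) ** ?S = mat 1"
    using arg_cong[OF inv(1), of transpose] by (simp add: matrix_transpose_mul S(1) transpose_mat)
  then show ?thesis
    by (metis inv(1) matrix_mul_assoc matrix_mul_lid matrix_mul_rid)
qed

subsection \<open>Quotients of power series\<close>

text \<open>Dividing by \<open>x ^ subdegree F\<close> leaves a series with nonzero constant term,
  which stays nonzero near \<open>0\<close> by continuity.\<close>

lemma eval_fps_eventually_nonzero:
  fixes F :: "real fps"
  assumes F: "F \<noteq> 0" and conv: "fps_conv_radius F > 0"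
  shows "\<forall>\<^sub>F x in at 0. eval_fps F x \<noteq> 0"
proof -
  define n where "n = subdegree F"
  have cG: "fps_conv_radius (fps_shift n F) > 0"
    using conv by simp
  then have "isCont (eval_fps (fps_shift n F)) 0"
    by (intro continuous_eval_fps) (simp add: zero_ereal_def)
  moreover have "eval_fps (fps_shift n F) 0 \<noteq> 0"
    using F by (simp add: eval_fps_at_0 n_def)
  ultimately have "\<forall>\<^sub>F x in at 0. eval_fps (fps_shift n F) x \<noteq> 0"
    by (intro tendsto_imp_eventually_ne) (auto simp: isCont_def)
  moreover have "\<forall>\<^sub>F x::real in nhds 0. x \<in> eball 0 (fps_conv_radius F)"
    by (intro eventually_nhds_in_open) (use conv in \<open>auto simp: zero_ereal_def\<close>)
  then have "\<forall>\<^sub>F x::real in at 0. x \<in> eball 0 (fps_conv_radius F)"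
    by (simp add: eventually_nhds_conv_at)
  moreover have "\<forall>\<^sub>F x::real in at 0. x \<noteq> 0"
    by (simp add: eventually_at_filter)
  ultimately show ?thesis
  proof eventually_elim
    case (elim x)
    with eval_fps_shift[of n F x] show ?case by (auto simp: n_def in_eball_iff)
  qed
qed

text \<open>The quotient is monotone near \<open>0\<close> in one direction or the other. As it
  vanishes at \<open>0\<close>, its absolute value is increasing in both cases.\<close>

lemma eval_fps_quotient_abs_mono:
  fixes P Q :: "real fps"
  assumes cP: "fps_conv_radius P > 0" and cQ: "fps_conv_radius Q > 0"
    and P0: "fps_nth P 0 = 0" and Q0: "fps_nth Q 0 \<noteq> 0"
  obtains \<epsilon> where "\<epsilon> > 0" "mono_on {0..\<epsilon>} (\<lambda>x. \<bar>eval_fps P x / eval_fps Q x\<bar>)"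
proof -
  \<comment> \<open>The derivative of the quotient is \<open>W\<close> divided by the square of
    \<open>Q\<close>. Being a power series, \<open>W\<close> is zero or has no zeros near
    \<open>0\<close> except possibly \<open>0\<close>, which excludes oscillation.\<close>
  define W where "W = fps_deriv P * Q - P * fps_deriv Q"
  define r where "r = min (fps_conv_radius P) (fps_conv_radius Q)"
  have r: "r > 0" using cP cQ by (simp add: r_def)
  have conv: "norm x < fps_conv_radius P" "norm x < fps_conv_radius Q"
    "norm x < fps_conv_radius (fps_deriv P)" "norm x < fps_conv_radius (fps_deriv Q)"
    if "x \<in> eball 0 r" for x
    using that order_less_le_trans[OF _ fps_conv_radius_deriv]
    by (auto simp: r_def in_eball_iff)
  have cm: "norm x < fps_conv_radius (fps_deriv P * Q)" "norm x < fps_conv_radius (P * fps_deriv Q)"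
    if "x \<in> eball 0 r" for x
    using conv[OF that] by (auto intro!: order_less_le_trans[OF _ fps_conv_radius_mult])
  have cW: "norm x < fps_conv_radius W" if "x \<in> eball 0 r" for x
    unfolding W_def using cm[OF that] by (auto intro!: order_less_le_trans[OF _ fps_conv_radius_diff])
  have W: "eval_fps W x = eval_fps (fps_deriv P) x * eval_fps Q x - eval_fps P x * eval_fps (fps_deriv Q) x"
    if "x \<in> eball 0 r" for x
    unfolding W_def using conv[OF that] cm[OF that] by (simp add: eval_fps_diff eval_fps_mult)
  have r0: "0 \<in> eball 0 r" using r by (simp add: zero_ereal_def)
  have "isCont (eval_fps Q) 0"
    by (intro continuous_eval_fps) (use conv(2)[OF r0] in simp)
  then have "\<forall>\<^sub>F x in at 0. eval_fps Q x \<noteq> 0"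
    using Q0 by (intro tendsto_imp_eventually_ne) (auto simp: isCont_def eval_fps_at_0)
  moreover have "\<forall>\<^sub>F x::real in nhds 0. x \<in> eball 0 r"
    by (intro eventually_nhds_in_open) (use r0 in auto)
  then have "\<forall>\<^sub>F x::real in at 0. x \<in> eball 0 r"
    by (simp add: eventually_nhds_conv_at)
  moreover have "\<forall>\<^sub>F x in at 0. W = 0 \<or> eval_fps W x \<noteq> 0"
  proof (cases "W = 0")
    case False
    have "fps_conv_radius W > 0" using cW[OF r0] by (simp add: zero_ereal_def)
    from eval_fps_eventually_nonzero[OF False this] show ?thesis
      by (rule eventually_mono) simp
  qed simp
  ultimately have "\<forall>\<^sub>F x in at 0. eval_fps Q x \<noteq> 0 \<and> x \<in> eball 0 r \<and> (W = 0 \<or> eval_fps W x \<noteq> 0)"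
    by eventually_elim simp
  then obtain e where e: "e > 0"
    "\<And>x. \<lbrakk>x \<noteq> 0; \<bar>x\<bar> < e\<rbrakk> \<Longrightarrow> eval_fps Q x \<noteq> 0 \<and> x \<in> eball 0 r \<and> (W = 0 \<or> eval_fps W x \<noteq> 0)"
    by (auto simp: eventually_at dist_real_def)
  \<comment> \<open>Halving \<open>e\<close> puts the closed interval up to
    \<open>\<epsilon>\<close> inside the region of the eventual properties. The point
    \<open>0\<close>, which the punctured filter omits, is covered by \<open>Q0\<close> and
    \<open>r0\<close>.\<close>
  define \<epsilon> where "\<epsilon> = e / 2"
  have \<epsilon>: "\<epsilon> > 0" "\<epsilon> < e" using e(1) by (auto simp: \<epsilon>_def)
  have Qnz: "eval_fps Q x \<noteq> 0" and xr: "x \<in> eball 0 r" if "x \<in> {0..\<epsilon>}" for x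
    using e(2)[of x] that \<epsilon> Q0 r0 by (cases "x = 0"; auto simp: eval_fps_at_0)+
  define h where "h x = eval_fps P x / eval_fps Q x" for x
  define h' where "h' x = eval_fps W x / (eval_fps Q x * eval_fps Q x)" for x
  have deriv: "(h has_real_derivative h' x) (at x within A)" if "x \<in> {0..\<epsilon>}" for x A
    unfolding h_def h'_def W[OF xr[OF that]]
    using conv[OF xr[OF that]] Qnz[OF that]
    by (intro DERIV_divide has_field_derivative_eval_fps) auto
  have h0: "h 0 = 0" by (simp add: h_def eval_fps_at_0 P0)
  have contW: "continuous_on {0..\<epsilon>} (eval_fps W)"
    by (intro continuous_at_imp_continuous_on ballI continuous_eval_fps cW xr)
  have sign: "(\<forall>x\<in>{0<..<\<epsilon>}. 0 \<le> h' x) \<or> (\<forall>x\<in>{0<..<\<epsilon>}. h' x \<le> 0)"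
  proof (cases "W = 0")
    case True
    then show ?thesis by (simp add: h'_def)
  next
    case False
    have nz: "eval_fps W x \<noteq> 0" if "x \<in> {0<..<\<epsilon>}" for x
      using e(2)[of x] that \<epsilon> False by auto
    \<comment> \<open>By the intermediate value property, a continuous function without zeros on an
      interval has constant sign there.\<close>
    have "connected (eval_fps W ` {0<..<\<epsilon>})"
      by (intro connected_continuous_image continuous_on_subset[OF contW]) auto
    then have "(\<forall>x\<in>{0<..<\<epsilon>}. 0 \<le> eval_fps W x) \<or> (\<forall>x\<in>{0<..<\<epsilon>}. eval_fps W x \<le> 0)"
      using nz unfolding connected_iff_interval by (smt (verit) imageE imageI)
    then show ?thesis
      by (auto simp: h'_def divide_nonpos_nonneg)
  qed
  have "mono_on {0..\<epsilon>} (\<lambda>x. \<bar>h x\<bar>)"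
    using sign
  proof
    assume *: "\<forall>x\<in>{0<..<\<epsilon>}. 0 \<le> h' x"
    have le: "h x \<le> h y" if "0 \<le> x" "x \<le> y" "y \<le> \<epsilon>" for x y
    proof (rule DERIV_nonneg_imp_increasing_open[OF \<open>x \<le> y\<close>])
      show "\<exists>z. (h has_real_derivative z) (at t) \<and> 0 \<le> z" if "x < t" "t < y" for t
        using deriv[of t UNIV] * that \<open>0 \<le> x\<close> \<open>y \<le> \<epsilon>\<close> by (intro exI[of _ "h' t"]) auto
      show "continuous_on {x..y} h"
        by (rule DERIV_continuous_on, rule deriv) (use \<open>0 \<le> x\<close> \<open>y \<le> \<epsilon>\<close> in auto)
    qed
    show ?thesis
      using le[of 0] le h0 by (auto simp: mono_on_def)
  next
    assume *: "\<forall>x\<in>{0<..<\<epsilon>}. h' x \<le> 0"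
    have le: "h y \<le> h x" if "0 \<le> x" "x \<le> y" "y \<le> \<epsilon>" for x y
    proof (rule DERIV_nonpos_imp_decreasing_open[OF \<open>x \<le> y\<close>])
      show "\<exists>z. (h has_real_derivative z) (at t) \<and> z \<le> 0" if "x < t" "t < y" for t
        using deriv[of t UNIV] * that \<open>0 \<le> x\<close> \<open>y \<le> \<epsilon>\<close> by (intro exI[of _ "h' t"]) auto
      show "continuous_on {x..y} h"
        by (rule DERIV_continuous_on, rule deriv) (use \<open>0 \<le> x\<close> \<open>y \<le> \<epsilon>\<close> in auto)
    qed
    show ?thesis
      using le[of 0] le h0 by (auto simp: mono_on_def)
  qed
  with \<epsilon>(1) show ?thesis by (auto intro: that simp: h_def)
qed

section \<open>Power series in \<open>1 / \<beta>\<close> as \<open>\<beta>\<close> tends to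
  infinity\<close>

lemma filterlim_inverse_at_0_at_top: "filterlim (\<lambda>\<beta>::real. 1 / \<beta>) (at 0) at_top"
  unfolding filterlim_at
proof
  show "\<forall>\<^sub>F \<beta>::real in at_top. 1 / \<beta> \<in> UNIV \<and> 1 / \<beta> \<noteq> 0"
    using eventually_gt_at_top[of 0] by eventually_elim simp
  show "((\<lambda>\<beta>::real. 1 / \<beta>) \<longlongrightarrow> 0) at_top"
    by (intro tendsto_divide_0[OF tendsto_const] filterlim_at_top_imp_at_infinity filterlim_ident)
qed

text \<open>The substitution \<open>x = 1 / \<beta>\<close> reverses the order and carries the
  half-line from \<open>1 / \<epsilon>\<close> into the interval of monotonicity.\<close>

lemma eval_fps_quotient_at_top:
  fixes P Q :: "real fps"
  assumes cP: "fps_conv_radius P > 0" and cQ: "fps_conv_radius Q > 0"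
    and P0: "fps_nth P 0 = 0" and Q0: "fps_nth Q 0 \<noteq> 0"
  shows "\<exists>\<beta>0. antimono_on {\<beta>0..} (\<lambda>\<beta>. \<bar>eval_fps P (1 / \<beta>) / eval_fps Q (1 / \<beta>)\<bar>)"
    and "((\<lambda>\<beta>. \<bar>eval_fps P (1 / \<beta>) / eval_fps Q (1 / \<beta>)\<bar>) \<longlongrightarrow> 0) at_top"
proof -
  obtain \<epsilon> where \<epsilon>: "\<epsilon> > 0" "mono_on {0..\<epsilon>} (\<lambda>x. \<bar>eval_fps P x / eval_fps Q x\<bar>)"
    using eval_fps_quotient_abs_mono[OF assms] .
  have "antimono_on {1 / \<epsilon>..} (\<lambda>\<beta>. \<bar>eval_fps P (1 / \<beta>) / eval_fps Q (1 / \<beta>)\<bar>)"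
  proof (rule monotone_onI)
    fix x y assume xy: "x \<in> {1 / \<epsilon>..}" "y \<in> {1 / \<epsilon>..}" "x \<le> y"
    moreover have "1 / \<epsilon> > 0" using \<epsilon>(1) by simp
    ultimately have "0 < x" "0 < y" by (auto simp del: zero_less_divide_1_iff)
    with xy \<epsilon> show "\<bar>eval_fps P (1 / y) / eval_fps Q (1 / y)\<bar> \<le> \<bar>eval_fps P (1 / x) / eval_fps Q (1 / x)\<bar>"
      by (intro mono_onD[OF \<epsilon>(2)]) (auto simp: field_simps)
  qed
  then show "\<exists>\<beta>0. antimono_on {\<beta>0..} (\<lambda>\<beta>. \<bar>eval_fps P (1 / \<beta>) / eval_fps Q (1 / \<beta>)\<bar>)" ..
  have "isCont (\<lambda>x. \<bar>eval_fps P x / eval_fps Q x\<bar>) 0"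
    by (intro continuous_intros continuous_eval_fps)
       (use cP cQ Q0 in \<open>auto simp: zero_ereal_def eval_fps_at_0\<close>)
  then have "(\<lambda>x. \<bar>eval_fps P x / eval_fps Q x\<bar>) \<midarrow>0\<rightarrow> 0"
    by (simp add: isCont_def eval_fps_at_0 P0)
  from filterlim_compose[OF this filterlim_inverse_at_0_at_top]
  show "((\<lambda>\<beta>. \<bar>eval_fps P (1 / \<beta>) / eval_fps Q (1 / \<beta>)\<bar>) \<longlongrightarrow> 0) at_top" .
qed

text \<open>Convergence at a single \<open>\<beta> > 0\<close> bounds the radius below by
  \<open>1 / \<beta>\<close>, so a series given only for large \<open>\<beta>\<close> defines an
  analytic function near \<open>0\<close>.\<close>

lemma real_powser_at_top:
  fixes a :: "nat \<Rightarrow> real"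
  assumes "\<forall>\<^sub>F \<beta> in at_top. (\<lambda>k. (1 / \<beta>) ^ k * a k) sums g \<beta>"
  shows "fps_conv_radius (Abs_fps a) > 0"
    and "\<forall>\<^sub>F \<beta> in at_top. g \<beta> = eval_fps (Abs_fps a) (1 / \<beta>)"
proof -
  have "\<forall>\<^sub>F \<beta> in at_top. \<beta> > 0 \<and> (\<lambda>k. (1 / \<beta>) ^ k * a k) sums g \<beta>"
    using assms eventually_gt_at_top[of 0] by eventually_elim simp
  then obtain \<beta> where \<beta>: "\<beta> > 0" "(\<lambda>k. (1 / \<beta>) ^ k * a k) sums g \<beta>"
    using eventually_happens[of _ "at_top::real filter"] trivial_limit_at_top_linorder by blast
  have "0 < ereal (norm (1 / \<beta>))" using \<beta>(1) by simp
  also have "\<dots> \<le> conv_radius a"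
    using sums_summable[OF \<beta>(2)] by (intro conv_radius_geI) (simp add: mult.commute)
  finally show "fps_conv_radius (Abs_fps a) > 0"
    by (simp add: fps_conv_radius_def)
  show "\<forall>\<^sub>F \<beta> in at_top. g \<beta> = eval_fps (Abs_fps a) (1 / \<beta>)"
    using assms by eventually_elim (simp add: eval_fps_def sums_iff mult.commute)
qed

text \<open>The coefficient \<open>a 1\<close> is the derivative at \<open>x = 0\<close> of the sum
  as a function of \<open>x = 1 / \<beta>\<close>. Passing to components reduces this to real series
  and serves eigenvectors and eigenvalues alike.\<close>

lemma powser_at_top_first_order:
  fixes a :: "nat \<Rightarrow> 'a::euclidean_space"
  assumes ev: "\<forall>\<^sub>F \<beta> in at_top. (\<lambda>k. (1 / \<beta>) ^ k *\<^sub>R a k) sums f \<beta>"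
  shows "((\<lambda>\<beta>. \<beta> *\<^sub>R (f \<beta> - a 0)) \<longlongrightarrow> a 1) at_top"
  unfolding tendsto_componentwise_iff[of _ "a 1"]
proof
  fix b :: 'a assume "b \<in> Basis"
  let ?F = "Abs_fps (\<lambda>k. a k \<bullet> b)"
  have "\<forall>\<^sub>F \<beta> in at_top. (\<lambda>k. (1 / \<beta>) ^ k * (a k \<bullet> b)) sums (f \<beta> \<bullet> b)"
    using ev
  proof eventually_elim
    case (elim \<beta>)
    from bounded_linear.sums[OF bounded_linear_inner_left[of b] elim] show ?case by simp
  qed
  note F = real_powser_at_top[OF this]
  have "(eval_fps ?F has_field_derivative eval_fps (fps_deriv ?F) 0) (at 0)"
    using F(1) by (intro has_field_derivative_eval_fps) (simp add: zero_ereal_def)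
  then have "((\<lambda>x. (eval_fps ?F x - a 0 \<bullet> b) / x) \<longlongrightarrow> a 1 \<bullet> b) (at 0)"
    by (simp add: DERIV_def eval_fps_at_0)
  from filterlim_compose[OF this filterlim_inverse_at_0_at_top]
  have "((\<lambda>\<beta>. \<beta> * (eval_fps ?F (1 / \<beta>) - a 0 \<bullet> b)) \<longlongrightarrow> a 1 \<bullet> b) at_top"
    by (simp add: mult.commute)
  moreover have "\<forall>\<^sub>F \<beta> in at_top. \<beta> * (eval_fps ?F (1 / \<beta>) - a 0 \<bullet> b) = (\<beta> *\<^sub>R (f \<beta> - a 0)) \<bullet> b"
    using F(2) by eventually_elim (simp add: inner_diff_left)
  ultimately show "((\<lambda>\<beta>. (\<beta> *\<^sub>R (f \<beta> - a 0)) \<bullet> b) \<longlongrightarrow> a 1 \<bullet> b) at_top"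
    by (rule Lim_transform_eventually)
qed

text \<open>Since \<open>1 / \<beta>\<close> is real, the real and imaginary parts of the
  coefficients form two real series, to which the quotient lemmas apply.\<close>

lemma complex_powser_at_top:
  fixes a :: "nat \<Rightarrow> complex"
  assumes "\<forall>\<^sub>F \<beta> in at_top. (\<lambda>k. (1 / \<beta>) ^ k *\<^sub>R a k) sums g \<beta>"
  defines "P \<equiv> Abs_fps (\<lambda>k. Re (a k))" and "Q \<equiv> Abs_fps (\<lambda>k. Im (a k))"
  shows "fps_conv_radius P > 0" "fps_conv_radius Q > 0"
    "\<forall>\<^sub>F \<beta> in at_top. Re (g \<beta>) = eval_fps P (1 / \<beta>)"
    "\<forall>\<^sub>F \<beta> in at_top. Im (g \<beta>) = eval_fps Q (1 / \<beta>)"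
proof -
  have "\<forall>\<^sub>F \<beta> in at_top. (\<lambda>k. (1 / \<beta>) ^ k * Re (a k)) sums Re (g \<beta>)"
    using assms(1) by eventually_elim (drule sums_Re, simp)
  from real_powser_at_top[OF this]
  show "fps_conv_radius P > 0" "\<forall>\<^sub>F \<beta> in at_top. Re (g \<beta>) = eval_fps P (1 / \<beta>)"
    by (simp_all add: P_def)
  have "\<forall>\<^sub>F \<beta> in at_top. (\<lambda>k. (1 / \<beta>) ^ k * Im (a k)) sums Im (g \<beta>)"
    using assms(1) by eventually_elim (drule sums_Im, simp)
  from real_powser_at_top[OF this]
  show "fps_conv_radius Q > 0" "\<forall>\<^sub>F \<beta> in at_top. Im (g \<beta>) = eval_fps Q (1 / \<beta>)"
    by (simp_all add: Q_def)
qed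

lemma eval_fps_at_top_tendsto:
  fixes F :: "real fps"
  assumes "fps_conv_radius F > 0"
  shows "((\<lambda>\<beta>. eval_fps F (1 / \<beta>)) \<longlongrightarrow> fps_nth F 0) at_top"
proof -
  have "isCont (eval_fps F) 0"
    using assms by (intro continuous_eval_fps) (simp add: zero_ereal_def)
  then have "eval_fps F \<midarrow>0\<rightarrow> fps_nth F 0"
    by (simp add: isCont_def eval_fps_at_0)
  from filterlim_compose[OF this filterlim_inverse_at_0_at_top] show ?thesis .
qed

section \<open>Monotonicity and limits of quality factors\<close>

lemma eventually_decreases_to_cong:
  assumes "\<forall>\<^sub>F \<beta> in at_top. f \<beta> = g \<beta>" and g: "eventually_decreases_to g L"
  shows "eventually_decreases_to f L"
proof -
  obtain N where N: "\<And>\<beta>. \<beta> \<ge> N \<Longrightarrow> f \<beta> = g \<beta>"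
    using assms(1) by (auto simp: eventually_at_top_linorder)
  obtain \<beta>0 where "antimono_on {\<beta>0..} g"
    using g by (auto simp: eventually_decreases_to_def)
  then have "antimono_on {max \<beta>0 N..} f"
    by (auto simp: monotone_on_def N)
  moreover have "(f \<longlongrightarrow> L) at_top"
    using g assms(1) by (simp add: eventually_decreases_to_def cong: tendsto_cong)
  ultimately show ?thesis by (auto simp: eventually_decreases_to_def)
qed

lemma eventually_increases_to_cong:
  assumes "\<forall>\<^sub>F \<beta> in at_top. f \<beta> = g \<beta>" and g: "eventually_increases_to g L"
  shows "eventually_increases_to f L"
proof -
  obtain N where N: "\<And>\<beta>. \<beta> \<ge> N \<Longrightarrow> f \<beta> = g \<beta>"
    using assms(1) by (auto simp: eventually_at_top_linorder)
  obtain \<beta>0 where "mono_on {\<beta>0..} g"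
    using g by (auto simp: eventually_increases_to_def)
  then have "mono_on {max \<beta>0 N..} f"
    by (auto simp: monotone_on_def N)
  moreover have "(f \<longlongrightarrow> L) at_top"
    using g assms(1) by (simp add: eventually_increases_to_def cong: tendsto_cong)
  ultimately show ?thesis by (auto simp: eventually_increases_to_def)
qed

text \<open>The positive factor \<open>s\<close> cancels in the quotient of \<open>Re\<close> and
  \<open>Im\<close>; it normalises eigenvalues of different growth to the leading coefficient
  \<open>- \<i> d\<close>. As \<open>d > 0\<close>, \<open>Im\<close> is eventually negative, so the
  finite branch of \<open>quality_factor\<close> applies.\<close>

lemma quality_factor_decreases:
  assumes ev: "\<forall>\<^sub>F \<beta> in at_top. (\<lambda>k. (1 / \<beta>) ^ k *\<^sub>R a k) sums (s \<beta> *\<^sub>R z \<beta>)"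
    and s: "\<forall>\<^sub>F \<beta> in at_top. s \<beta> > 0"
    and a0: "a 0 = - \<i> * complex_of_real d" and d: "d > 0"
  shows "eventually_decreases_to (\<lambda>\<beta>. quality_factor (z \<beta>)) 0"
proof -
  define P Q where "P = Abs_fps (\<lambda>k. Re (a k))" and "Q = Abs_fps (\<lambda>k. Im (a k))"
  note PQ = complex_powser_at_top[OF ev, folded P_def Q_def]
  have P0: "fps_nth P 0 = 0" and Q0: "fps_nth Q 0 = - d"
    using a0 by (simp_all add: P_def Q_def)
  define h where "h \<beta> = \<bar>eval_fps P (1 / \<beta>) / eval_fps Q (1 / \<beta>)\<bar>" for \<beta>
  have h: "\<exists>\<beta>0. antimono_on {\<beta>0..} h" "(h \<longlongrightarrow> 0) at_top"
    unfolding h_def using eval_fps_quotient_at_top[OF PQ(1,2) P0] Q0 d by auto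
  have "\<forall>\<^sub>F \<beta> in at_top. eval_fps Q (1 / \<beta>) < 0"
    by (rule order_tendstoD(2)[OF eval_fps_at_top_tendsto[OF PQ(2)]]) (use Q0 d in simp)
  then have "\<forall>\<^sub>F \<beta> in at_top. quality_factor (z \<beta>) = ereal (1 / 2 * h \<beta>)"
    using s PQ(3,4)
  proof eventually_elim
    case (elim \<beta>)
    then have "s \<beta> * Im (z \<beta>) < 0" by simp
    with elim(2) have "Im (z \<beta>) < 0" by (auto simp: mult_less_0_iff)
    moreover have "h \<beta> = \<bar>Re (z \<beta>)\<bar> / \<bar>Im (z \<beta>)\<bar>"
      using elim by (simp add: h_def flip: elim(3,4))
    ultimately show ?case by (auto simp: quality_factor_def)
  qed
  moreover have "eventually_decreases_to (\<lambda>\<beta>. ereal (1 / 2 * h \<beta>)) 0"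
  proof -
    obtain \<beta>0 where "antimono_on {\<beta>0..} h" using h(1) by blast
    then have "antimono_on {\<beta>0..} (\<lambda>\<beta>. ereal (1 / 2 * h \<beta>))"
      by (auto simp: monotone_on_def)
    moreover have "((\<lambda>\<beta>. ereal (1 / 2 * h \<beta>)) \<longlongrightarrow> ereal (1 / 2 * 0)) at_top"
      by (intro tendsto_intros h(2))
    ultimately show ?thesis by (auto simp: eventually_decreases_to_def zero_ereal_def)
  qed
  ultimately show ?thesis by (rule eventually_decreases_to_cong)
qed

text \<open>Inverting in \<open>ereal\<close> treats both branches at once:
  \<open>h \<beta> = 0\<close> means \<open>Im (z \<beta>) = 0\<close> and gives
  \<open>\<infinity>\<close>, in accordance with \<open>quality_factor\<close>. The leading
  coefficient does not determine the sign of \<open>Im\<close>, so that sign is an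
  assumption.\<close>

lemma quality_factor_increases:
  assumes ev: "\<forall>\<^sub>F \<beta> in at_top. (\<lambda>k. (1 / \<beta>) ^ k *\<^sub>R a k) sums z \<beta>"
    and Im: "\<forall>\<^sub>F \<beta> in at_top. Im (z \<beta>) \<le> 0"
    and a0: "a 0 = complex_of_real \<rho>" and \<rho>: "\<rho> \<noteq> 0"
  shows "eventually_increases_to (\<lambda>\<beta>. quality_factor (z \<beta>)) \<infinity>"
proof -
  define P Q where "P = Abs_fps (\<lambda>k. Re (a k))" and "Q = Abs_fps (\<lambda>k. Im (a k))"
  note PQ = complex_powser_at_top[OF ev, folded P_def Q_def]
  have Q0: "fps_nth Q 0 = 0" and P0: "fps_nth P 0 \<noteq> 0"
    using a0 \<rho> by (simp_all add: P_def Q_def)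
  define h where "h \<beta> = \<bar>eval_fps Q (1 / \<beta>) / eval_fps P (1 / \<beta>)\<bar>" for \<beta>
  have h: "\<exists>\<beta>0. antimono_on {\<beta>0..} h" "(h \<longlongrightarrow> 0) at_top"
    unfolding h_def using eval_fps_quotient_at_top[OF PQ(2,1) Q0 P0] by auto
  have h_nonneg: "h \<beta> \<ge> 0" for \<beta> by (simp add: h_def)
  have "\<forall>\<^sub>F \<beta> in at_top. eval_fps P (1 / \<beta>) \<noteq> 0"
    by (rule tendsto_imp_eventually_ne[OF eval_fps_at_top_tendsto[OF PQ(1)] P0])
  then have "\<forall>\<^sub>F \<beta> in at_top. quality_factor (z \<beta>) = inverse (ereal (2 * h \<beta>))"
    using Im PQ(3,4)
  proof eventually_elim
    case (elim \<beta>)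
    then have "Re (z \<beta>) \<noteq> 0" by simp
    moreover from this have "z \<beta> \<noteq> 0" by auto
    moreover have "h \<beta> = \<bar>Im (z \<beta>)\<bar> / \<bar>Re (z \<beta>)\<bar>"
      by (simp add: h_def flip: elim(3,4))
    ultimately show ?case using elim(2) by (auto simp: quality_factor_def)
  qed
  moreover have "eventually_increases_to (\<lambda>\<beta>. inverse (ereal (2 * h \<beta>))) \<infinity>"
    unfolding eventually_increases_to_def
  proof
    obtain \<beta>0 where \<beta>0: "antimono_on {\<beta>0..} h" using h(1) by blast
    have "mono_on {\<beta>0..} (\<lambda>\<beta>. inverse (ereal (2 * h \<beta>)))"
    proof (intro mono_onI ereal_inverse_antimono)
      fix x y assume "x \<in> {\<beta>0..}" "y \<in> {\<beta>0..}" "x \<le> y"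
      then show "ereal (2 * h y) \<le> ereal (2 * h x)"
        using monotone_onD[OF \<beta>0] by simp
      show "0 \<le> ereal (2 * h y)" by (simp add: h_nonneg)
    qed
    then show "\<exists>\<beta>0. mono_on {\<beta>0..} (\<lambda>\<beta>. inverse (ereal (2 * h \<beta>)))" ..
    show "((\<lambda>\<beta>. inverse (ereal (2 * h \<beta>))) \<longlongrightarrow> \<infinity>) at_top"
    proof (rule tendsto_PInfty[THEN iffD2], rule allI)
      fix r :: real
      \<comment> \<open>\<open>m\<close> is positive and exceeds \<open>r\<close>, so that
        \<open>h \<beta> < 1 / (2 * m)\<close> can be inverted whatever the sign of
        \<open>r\<close>.\<close>
      define m where "m = \<bar>r\<bar> + 1"
      have "1 / (2 * m) > 0" by (simp add: m_def)
      from order_tendstoD(2)[OF h(2) this] 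
      show "\<forall>\<^sub>F \<beta> in at_top. ereal r < inverse (ereal (2 * h \<beta>))"
      proof eventually_elim
        case (elim \<beta>)
        show ?case
        proof (cases "h \<beta> = 0")
          case False
          then have "h \<beta> > 0" using h_nonneg[of \<beta>] by linarith
          moreover have "m > 0" by (simp add: m_def)
          ultimately have "m < 1 / (2 * h \<beta>)"
            using elim by (simp add: field_simps)
          then have "r < 1 / (2 * h \<beta>)" by (simp add: m_def)
          with False show ?thesis by (simp add: inverse_eq_divide)
        qed simp
      qed
    qed
  qed
  ultimately show ?thesis by (rule eventually_increases_to_cong)
qed

subsection \<open>Perturbation of dissipative matrices\<close>

lemma cdot_diff_right: "cdot x (y - z) = cdot x y - cdot x z"
  by (simp add: cdot_def algebra_simps sum_subtractf)

lemma cdot_scale_right: "cdot x (c *s y) = c * cdot x y"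
  by (simp add: cdot_def sum_distrib_left algebra_simps)

lemma cdot_scale_left: "cdot (c *s x) y = cnj c * cdot x y"
  by (simp add: cdot_def sum_distrib_left algebra_simps)

lemma cdot_scaleR_right: "cdot x (r *\<^sub>R y) = of_real r * cdot x y"
  unfolding cdot_def vector_scaleR_component by (simp add: sum_distrib_left scaleR_conv_of_real[where 'a=complex] algebra_simps)

lemma cdot_zero [simp]: "cdot x 0 = 0" "cdot 0 y = 0"
  by (simp_all add: cdot_def)

lemma cnj_cdot: "cnj (cdot x y) = cdot y x"
  by (simp add: cdot_def mult.commute)

lemma cdot_self: "cdot x x = of_real ((norm x)\<^sup>2)"
proof -
  have "cdot x x = of_real (\<Sum>i\<in>UNIV. (norm (x $ i))\<^sup>2)"
    unfolding cdot_def of_real_sum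
    by (intro sum.cong refl) (metis complex_norm_square mult.commute)
  then show ?thesis
    by (simp add: norm_vec_def L2_set_def sum_nonneg)
qed

lemma tendsto_cdot [tendsto_intros]:
  assumes "(f \<longlongrightarrow> x) F" "(g \<longlongrightarrow> y) F"
  shows "((\<lambda>t. cdot (f t) (g t)) \<longlongrightarrow> cdot x y) F"
  unfolding cdot_def by (intro tendsto_intros assms)

lemma cdot_adjoint:
  assumes "\<And>i j. M $ i $ j = cnj (M' $ j $ i)"
  shows "cdot x (M *v y) = cdot (M' *v x) y"
proof -
  have "cdot x (M *v y) = (\<Sum>i\<in>UNIV. \<Sum>j\<in>UNIV. cnj (x $ i) * (M $ i $ j * y $ j))"
    by (simp add: cdot_def matrix_vector_mult_def sum_distrib_left)
  also have "\<dots> = (\<Sum>j\<in>UNIV. \<Sum>i\<in>UNIV. cnj (x $ i) * (M $ i $ j * y $ j))"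
    by (rule sum.swap)
  also have "\<dots> = cdot (M' *v x) y"
    by (simp add: cdot_def matrix_vector_mult_def sum_distrib_right sum_distrib_left assms algebra_simps)
  finally show ?thesis .
qed

section \<open>Hermiticity of \<open>Omega_mat\<close> and a Gram factorisation of
  \<open>B_mat\<close>\<close>

lemma block_matrix_nth [simp]:
  "block_matrix M11 M12 M21 M22 $ Inl k $ Inl l = M11 $ k $ l"
  "block_matrix M11 M12 M21 M22 $ Inl k $ Inr m = M12 $ k $ m"
  "block_matrix M11 M12 M21 M22 $ Inr n $ Inl l = M21 $ n $ l"
  "block_matrix M11 M12 M21 M22 $ Inr n $ Inr m = M22 $ n $ m"
  by (simp_all add: block_matrix_def)

lemma map_matrix_nth [simp]: "map_matrix f M $ i $ j = f (M $ i $ j)"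
  by (simp add: map_matrix_def)

lemma sum_UNIV_Plus:
  fixes f :: "'a::finite + 'b::finite \<Rightarrow> 'c::comm_monoid_add"
  shows "sum f UNIV = (\<Sum>k\<in>UNIV. f (Inl k)) + (\<Sum>k\<in>UNIV. f (Inr k))"
  unfolding UNIV_Plus_UNIV[symmetric] by (subst sum.Plus) (auto simp: o_def)

text \<open>The upper left block is an imaginary multiple of a real skew matrix, and the opposite
  signs of \<open>\<i>\<close> make the off-diagonal blocks adjoint to each other.\<close>

lemma Omega_mat_hermitian:
  assumes "pos_def \<alpha>" and \<theta>: "transpose \<theta> = - \<theta>"
  shows "cdot x (Omega_mat \<alpha> \<eta> \<theta> *v y) = cdot (Omega_mat \<alpha> \<eta> \<theta> *v x) y"
proof (rule cdot_adjoint)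
  let ?T = "matrix_inv (psd_sqrt \<alpha>)"
  let ?U = "?T ** \<theta> ** ?T"
  have "transpose ?U = ?T ** (- \<theta>) ** ?T"
    by (simp add: matrix_transpose_mul transpose_inverse_psd_sqrt[OF assms(1)] \<theta> matrix_mul_assoc)
  also have "\<dots> = - ?U"
    by (simp add: vec_eq_iff matrix_matrix_mult_def sum_negf)
  finally have "transpose ?U = - ?U" .
  then have skew: "?U $ l $ k = - ?U $ k $ l" for k l
  proof -
    assume *: "transpose ?U = - ?U"
    have "?U $ l $ k = transpose ?U $ k $ l" by (simp only: transpose_def vec_lambda_beta)
    then show ?thesis by (simp only: * vector_uminus_component)
  qed
  show "Omega_mat \<alpha> \<eta> \<theta> $ i $ j = cnj (Omega_mat \<alpha> \<eta> \<theta> $ j $ i)" for i j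
  proof (cases i)
    case (Inl k)
    then show ?thesis
    proof (cases j)
      case (Inl l)
      with \<open>i = Inl k\<close> skew[of l k] show ?thesis by (simp add: Omega_mat_def)
    qed (simp add: Omega_mat_def transpose_def)
  qed (cases j; simp add: Omega_mat_def transpose_def)
qed

text \<open>This is positive semidefiniteness in factored form: \<open>B_mat \<alpha> R\<close> is
  the adjoint of \<open>C\<close> times \<open>C\<close>. It makes \<open>(x, B x)\<close> the
  squared norm of \<open>C x\<close> and lets \<open>C x = 0\<close> be deduced from
  \<open>B x = 0\<close>.\<close>

lemma B_mat_gram:
  fixes \<alpha> R :: "real^'n^'n"
  assumes "pos_def \<alpha>" and "pos_semidef R"
  shows "\<exists>C :: complex^('n + 'n)^('n + 'n). \<forall>x y. cdot x (B_mat \<alpha> R *v y) = cdot (C *v x) (C *v y)"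
proof -
  let ?T = "matrix_inv (psd_sqrt \<alpha>)"
  define K where "K = psd_sqrt R ** ?T"
  define C :: "complex^('n + 'n)^('n + 'n)" where "C = block_matrix (map_matrix complex_of_real K) 0 0 0"
  define C' where "C' = block_matrix (map_matrix complex_of_real (transpose K)) 0 0 0"
  have "transpose K ** K = ?T ** (psd_sqrt R ** psd_sqrt R) ** ?T"
    using psd_sqrt_works(1)[OF assms(2)]
    by (simp add: K_def pos_semidef_def matrix_transpose_mul transpose_inverse_psd_sqrt[OF assms(1)] matrix_mul_assoc)
  then have KK: "?T ** R ** ?T = transpose K ** K"
    by (simp add: psd_sqrt_works(2)[OF assms(2)])
  have "B_mat \<alpha> R $ i $ j = (C' ** C) $ i $ j" for i j
    unfolding B_mat_def KK C_def C'_def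
    by (cases i; cases j) (simp_all add: matrix_matrix_mult_def sum_UNIV_Plus)
  then have B: "B_mat \<alpha> R = C' ** C"
    by (simp add: vec_eq_iff)
  have "C' $ i $ j = cnj (C $ j $ i)" for i j
    unfolding C_def C'_def by (cases i; cases j) (simp_all add: transpose_def)
  then have "cdot x (B_mat \<alpha> R *v y) = cdot (C *v x) (C *v y)" for x y
    unfolding B matrix_vector_mul_assoc[symmetric] by (rule cdot_adjoint)
  then show ?thesis by blast
qed

section \<open>Eigenvalues of a Hermitian matrix with a dissipative term\<close>

lemma A_mat_mult_vec:
  "A_mat \<alpha> \<eta> \<theta> R \<beta> *v x = Omega_mat \<alpha> \<eta> \<theta> *v x - (\<i> * of_real \<beta>) *s (B_mat \<alpha> R *v x)"
  unfolding A_mat_def matrix_vector_mult_diff_rdistrib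
  by (simp add: vec_eq_iff matrix_vector_mult_def sum_distrib_left algebra_simps)

text \<open>After pairing the eigenvalue equation with \<open>w\<close>, the term
  \<open>(w, Om w)\<close> is real, and the imaginary part of the rest is \<open>- \<beta>\<close>
  times the squared norm of \<open>C w\<close>.\<close>

lemma dissipative_eigenvalue_Im_nonpos:
  fixes Om B C :: "complex^'m^'m"
  assumes herm: "\<And>x y. cdot x (Om *v y) = cdot (Om *v x) y"
    and gram: "\<And>x y. cdot x (B *v y) = cdot (C *v x) (C *v y)"
    and eig: "Om *v w - (\<i> * of_real \<beta>) *s (B *v w) = z *s w" and w: "w \<noteq> 0" and \<beta>: "0 \<le> \<beta>"
  shows "Im z \<le> 0"
proof -
  have "cnj (cdot w (Om *v w)) = cdot w (Om *v w)"
    by (simp add: cnj_cdot herm)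
  then have "Im (cdot w (Om *v w)) = 0"
    by (simp add: complex_eq_iff)
  moreover have "z * of_real ((norm w)\<^sup>2) = cdot w (Om *v w) - \<i> * of_real \<beta> * of_real ((norm (C *v w))\<^sup>2)"
    by (metis eig cdot_diff_right cdot_scale_right cdot_self gram)
  ultimately have "Im z * (norm w)\<^sup>2 = - (\<beta> * (norm (C *v w))\<^sup>2)"
    by (auto simp: complex_eq_iff)
  also have "\<dots> \<le> 0" using \<beta> by simp
  finally show ?thesis using w by (simp add: mult_le_0_iff)
qed

text \<open>Comparing orders in the eigenvalue equation gives \<open>\<Omega> w\<^sub>0 = \<i> B c\<close>, and pairing it with
  \<open>w\<^sub>0\<close> then gives the first-order coefficient \<open>a = - \<i> (c, B c) / (w\<^sub>0, w\<^sub>0)\<close>. If this vanishes, then \<open>w\<^sub>0\<close>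
  lies in the kernel of the adjoint of \<open>\<Omega> - \<i> \<beta> B\<close> for all \<open>\<beta>\<close>, which forces the eigenvalue of
  the nearby eigenvector to be zero.\<close>

lemma dissipative_eigenvalue_first_order:
  fixes Om B C :: "complex^'m^'m"
  assumes herm: "\<And>x y. cdot x (Om *v y) = cdot (Om *v x) y"
    and gram: "\<And>x y. cdot x (B *v y) = cdot (C *v x) (C *v y)"
    and eig: "\<forall>\<^sub>F \<beta> in at_top. Om *v w \<beta> - (\<i> * of_real \<beta>) *s (B *v w \<beta>) = z \<beta> *s w \<beta>"
    and w0: "B *v w0 = 0" "w0 \<noteq> 0"
    and w: "((\<lambda>\<beta>. \<beta> *\<^sub>R (w \<beta> - w0)) \<longlongrightarrow> c) at_top"
    and z: "((\<lambda>\<beta>. \<beta> *\<^sub>R z \<beta>) \<longlongrightarrow> a) at_top"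
  shows "(\<exists>d>0. a = - \<i> * complex_of_real d) \<or> (\<forall>\<^sub>F \<beta> in at_top. z \<beta> = 0)"
proof -
  have inv0: "((\<lambda>\<beta>::real. 1 / \<beta>) \<longlongrightarrow> 0) at_top"
    by (intro tendsto_divide_0[OF tendsto_const] filterlim_at_top_imp_at_infinity filterlim_ident)
  have pos: "\<forall>\<^sub>F \<beta>::real in at_top. \<beta> > 0" by (rule eventually_gt_at_top)
  \<comment> \<open>Convergence of the rescaled differences forces \<open>w\<close> to tend to
    \<open>w0\<close>, and in the same way \<open>z\<close> to \<open>0\<close>.\<close>
  have "((\<lambda>\<beta>. w0 + (1 / \<beta>) *\<^sub>R (\<beta> *\<^sub>R (w \<beta> - w0))) \<longlongrightarrow> w0 + 0 *\<^sub>R c) at_top"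
    by (intro tendsto_intros inv0 w)
  moreover have "\<forall>\<^sub>F \<beta> in at_top. w0 + (1 / \<beta>) *\<^sub>R (\<beta> *\<^sub>R (w \<beta> - w0)) = w \<beta>"
    using pos by eventually_elim simp
  ultimately have "(w \<longlongrightarrow> w0 + 0 *\<^sub>R c) at_top"
    by (rule Lim_transform_eventually)
  then have lim_w: "(w \<longlongrightarrow> w0) at_top" by simp
  have "((\<lambda>\<beta>. (1 / \<beta>) *\<^sub>R (\<beta> *\<^sub>R z \<beta>)) \<longlongrightarrow> 0 *\<^sub>R a) at_top"
    by (intro tendsto_intros inv0 z)
  moreover have "\<forall>\<^sub>F \<beta> in at_top. (1 / \<beta>) *\<^sub>R (\<beta> *\<^sub>R z \<beta>) = z \<beta>"
    using pos by eventually_elim simp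
  ultimately have "(z \<longlongrightarrow> 0 *\<^sub>R a) at_top"
    by (rule Lim_transform_eventually)
  then have lim_z: "(z \<longlongrightarrow> 0) at_top" by simp
  have lin: "((\<lambda>\<beta>. M *v f \<beta>) \<longlongrightarrow> M *v x) F" if "(f \<longlongrightarrow> x) F" for M :: "complex^'m^'m" and f x and F :: "real filter"
    using that by (rule bounded_linear.tendsto[OF matrix_vector_mul_bounded_linear])
  have scale: "((\<lambda>\<beta>. s \<beta> *s f \<beta>) \<longlongrightarrow> s0 *s x) F" if "(s \<longlongrightarrow> s0) F" "(f \<longlongrightarrow> x) F"
    for s :: "real \<Rightarrow> complex" and s0 and f :: "real \<Rightarrow> complex^'m" and x F
    unfolding vector_scalar_mult_def by (intro tendsto_vec_lambda tendsto_intros that)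
  \<comment> \<open>Because \<open>B w0 = 0\<close>, the term \<open>\<beta> B w\<close> equals
    \<open>B (\<beta> (w - w0))\<close>, which has the finite limit \<open>B c\<close>.\<close>
  have "((\<lambda>\<beta>. Om *v w \<beta> - \<i> *s (B *v (\<beta> *\<^sub>R (w \<beta> - w0)))) \<longlongrightarrow> Om *v w0 - \<i> *s (B *v c)) at_top"
    by (intro tendsto_diff lin scale tendsto_const lim_w w)
  moreover have "\<forall>\<^sub>F \<beta> in at_top. Om *v w \<beta> - \<i> *s (B *v (\<beta> *\<^sub>R (w \<beta> - w0))) = z \<beta> *s w \<beta>"
    using eig
  proof eventually_elim
    case (elim \<beta>)
    have "B *v (\<beta> *\<^sub>R (w \<beta> - w0)) = \<beta> *\<^sub>R (B *v w \<beta>)"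
      using w0(1) by (simp add: linear_scale[OF matrix_vector_mul_linear] linear_diff[OF matrix_vector_mul_linear])
    then have "\<i> *s (B *v (\<beta> *\<^sub>R (w \<beta> - w0))) = (\<i> * of_real \<beta>) *s (B *v w \<beta>)"
      unfolding vec_eq_iff vector_smult_component by (simp add: scaleR_conv_of_real[where 'a=complex])
    with elim show ?case by simp
  qed
  ultimately have "((\<lambda>\<beta>. z \<beta> *s w \<beta>) \<longlongrightarrow> Om *v w0 - \<i> *s (B *v c)) at_top"
    by (rule Lim_transform_eventually)
  moreover have "((\<lambda>\<beta>. z \<beta> *s w \<beta>) \<longlongrightarrow> 0 *s w0) at_top"
    by (intro scale lim_z lim_w)
  ultimately have "Om *v w0 - \<i> *s (B *v c) = 0 *s w0"
    by (rule tendsto_unique[rotated]) simp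
  then have Om_w0: "Om *v w0 = \<i> *s (B *v c)" by simp
  have "cdot (C *v w0) (C *v w0) = 0"
    using gram[of w0 w0] w0(1) by simp
  then have Cw0: "C *v w0 = 0" by (simp add: cdot_self)
  \<comment> \<open>Pairing with \<open>w0\<close> removes the \<open>B\<close> term exactly, not
    only in the limit, because \<open>C w0 = 0\<close>.\<close>
  have pair: "\<forall>\<^sub>F \<beta> in at_top. z \<beta> * cdot w0 (w \<beta>) = cdot (Om *v w0) (w \<beta>)"
    using eig
  proof eventually_elim
    case (elim \<beta>)
    from arg_cong[OF elim, of "cdot w0"] show ?case
      by (simp add: cdot_diff_right cdot_scale_right gram Cw0 herm)
  qed
  have lim_norm: "((\<lambda>\<beta>. cdot w0 (w \<beta>)) \<longlongrightarrow> cdot w0 w0) at_top"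
    by (intro tendsto_intros lim_w)
  have nz: "cdot w0 w0 \<noteq> 0" using w0(2) by (simp add: cdot_self)
  show ?thesis
  proof (cases "C *v c = 0")
    case True
    \<comment> \<open>Since \<open>(B c, B c) = (C B c, C c)\<close>, the vector \<open>B c\<close>
      and with it \<open>Om w0\<close> vanish; by \<open>pair\<close>, \<open>z\<close> times an
      eventually nonzero factor is then \<open>0\<close>.\<close>
    then have "cdot (B *v c) (B *v c) = 0" by (simp add: gram)
    then have 0: "Om *v w0 = 0" using Om_w0 by (simp add: cdot_self)
    have "\<forall>\<^sub>F \<beta> in at_top. z \<beta> = 0"
      using pair tendsto_imp_eventually_ne[OF lim_norm nz]
      by eventually_elim (simp add: 0)
    then show ?thesis ..
  next
    case False
    define d where "d = (norm (C *v c))\<^sup>2"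
    \<comment> \<open>Orthogonality of \<open>Om w0\<close> to \<open>w0\<close> allows
      \<open>w\<close> to be replaced by \<open>w - w0\<close> in \<open>pair\<close>, so that
      multiplication by \<open>\<beta>\<close> leads to a finite limit.\<close>
    have "cdot (B *v c) w0 = 0"
      by (metis cnj_cdot gram Cw0 cdot_zero complex_cnj_zero)
    then have 0: "cdot (Om *v w0) w0 = 0" by (simp add: Om_w0 cdot_scale_left)
    have "((\<lambda>\<beta>. (\<beta> *\<^sub>R z \<beta>) * cdot w0 (w \<beta>)) \<longlongrightarrow> a * cdot w0 w0) at_top"
      by (intro tendsto_mult z lim_norm)
    moreover have "\<forall>\<^sub>F \<beta> in at_top. (\<beta> *\<^sub>R z \<beta>) * cdot w0 (w \<beta>) = cdot (Om *v w0) (\<beta> *\<^sub>R (w \<beta> - w0))"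
      using pair by eventually_elim (simp add: cdot_scaleR_right cdot_diff_right 0 scaleR_conv_of_real[where 'a=complex])
    ultimately have "((\<lambda>\<beta>. cdot (Om *v w0) (\<beta> *\<^sub>R (w \<beta> - w0))) \<longlongrightarrow> a * cdot w0 w0) at_top"
      by (rule Lim_transform_eventually)
    moreover have "((\<lambda>\<beta>. cdot (Om *v w0) (\<beta> *\<^sub>R (w \<beta> - w0))) \<longlongrightarrow> cdot (Om *v w0) c) at_top"
      by (intro tendsto_intros w)
    ultimately have "a * cdot w0 w0 = cdot (Om *v w0) c"
      by (rule tendsto_unique[rotated]) simp
    also have "\<dots> = - \<i> * cnj (cdot c (B *v c))"
      by (simp add: Om_w0 cdot_scale_left cnj_cdot)
    also have "\<dots> = - \<i> * of_real d"
      by (simp add: gram cdot_self d_def)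
    finally have "a = - \<i> * of_real (d / (norm w0)\<^sup>2)"
      using w0(2) by (simp add: cdot_self field_simps)
    moreover have "d / (norm w0)\<^sup>2 > 0" using False w0(2) by (simp add: d_def)
    ultimately show ?thesis by blast
  qed
qed

subsection \<open>Quality factors for large losses\<close>

theorem theorem40:
  fixes \<alpha> \<eta> \<theta> R :: "real^'n^'n"
    and b \<rho> :: "nat \<Rightarrow> real"
    and w0 :: "nat \<Rightarrow> complex^('n + 'n)"
    and w :: "nat \<Rightarrow> real \<Rightarrow> complex^('n + 'n)"
    and \<zeta> :: "nat \<Rightarrow> real \<Rightarrow> complex"
  assumes "pos_def \<alpha>" and "pos_semidef \<eta>" and "transpose \<theta> = - \<theta>"
    and "pos_semidef R" and "0 < rank R"
    and "loss_eigensystem \<alpha> \<eta> \<theta> R b \<rho> w0 w \<zeta>"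
  shows "(\<forall>j\<in>{1..rank R}. eventually_decreases_to (\<lambda>\<beta>. quality_factor (\<zeta> j \<beta>)) 0) \<and>
    ({x. R *v x = 0} \<inter> {x. \<eta> *v x = 0} = {0} \<longrightarrow>
     (\<forall>j\<in>{rank R + 1..2 * rank R}. \<rho> j = 0) \<longrightarrow>
     (\<forall>j\<in>{2 * rank R + 1..2 * CARD('n)}. \<rho> j \<noteq> 0) \<longrightarrow>
     (\<forall>j\<in>{rank R + 1..2 * rank R}.
        eventually_decreases_to (\<lambda>\<beta>. quality_factor (\<zeta> j \<beta>)) 0) \<and>
     (\<forall>j\<in>{2 * rank R + 1..2 * CARD('n)}.
        eventually_increases_to (\<lambda>\<beta>. quality_factor (\<zeta> j \<beta>)) \<infinity>))"
proof -
  note hyps = assms(6)[unfolded loss_eigensystem_def Let_def]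
  have orth: "\<forall>i\<in>{1..2*CARD('n)}. \<forall>j\<in>{1..2*CARD('n)}. cdot (w0 i) (w0 j) = (if i = j then 1 else 0)"
    and b: "\<forall>j\<in>{1..rank R}. 0 < b j"
    and low: "\<forall>j\<in>{rank R+1..2*CARD('n)}. B_mat \<alpha> R *v w0 j = 0"
    and eig: "\<forall>\<^sub>F \<beta> in at_top. (\<forall>j\<in>{1..2*CARD('n)}. A_mat \<alpha> \<eta> \<theta> R \<beta> *v w j \<beta> = \<zeta> j \<beta> *s w j \<beta>) \<and>
         vec.independent ((\<lambda>j. w j \<beta>) ` {1..2*CARD('n)})"
    and w: "\<forall>j\<in>{1..2*CARD('n)}. \<exists>c. c 0 = w0 j \<and>
         (\<forall>\<^sub>F \<beta> in at_top. (\<lambda>k. (1 / \<beta>) ^ k *\<^sub>R c k) sums w j \<beta>)"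
    and high_ser: "\<forall>j\<in>{1..rank R}. \<exists>a. a 0 = - \<i> * complex_of_real (b j) \<and> a 1 = complex_of_real (\<rho> j) \<and>
         (\<forall>\<^sub>F \<beta> in at_top. (\<lambda>k. a k * complex_of_real (\<beta> powi (1 - int k))) sums \<zeta> j \<beta>)"
    and low_ser: "\<forall>j\<in>{rank R+1..2*CARD('n)}. \<exists>a. a 0 = complex_of_real (\<rho> j) \<and>
         (\<forall>\<^sub>F \<beta> in at_top. (\<lambda>k. a k * complex_of_real ((1 / \<beta>) ^ k)) sums \<zeta> j \<beta>)"
    using hyps by (auto elim: eventually_mono)
  note herm = Omega_mat_hermitian[OF assms(1,3), where \<eta> = \<eta>]
  obtain C :: "complex^('n + 'n)^('n + 'n)"
    where gram: "\<And>x y. cdot x (B_mat \<alpha> R *v y) = cdot (C *v x) (C *v y)"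
    using B_mat_gram[OF assms(1,4)] by blast
  \<comment> \<open>This keeps the indices up to \<open>2 * rank R\<close> within the range of the
    eigensystem.\<close>
  have rank: "rank R \<le> CARD('n)"
    using rank_bound[of R] by simp

  have high: "eventually_decreases_to (\<lambda>\<beta>. quality_factor (\<zeta> j \<beta>)) 0" if j: "j \<in> {1..rank R}" for j
  proof -
    obtain a where a: "a 0 = - \<i> * complex_of_real (b j)"
      "\<forall>\<^sub>F \<beta> in at_top. (\<lambda>k. a k * complex_of_real (\<beta> powi (1 - int k))) sums \<zeta> j \<beta>"
      using high_ser j by blast
    \<comment> \<open>Division by \<open>\<beta>\<close> shifts the exponent \<open>1 - k\<close> to
      \<open>- k\<close> and turns the Laurent series into a power series with constant term
      \<open>- \<i> b j\<close>.\<close>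
    have "\<forall>\<^sub>F \<beta> in at_top. (\<lambda>k. (1 / \<beta>) ^ k *\<^sub>R a k) sums ((1 / \<beta>) *\<^sub>R \<zeta> j \<beta>)"
      using a(2) eventually_gt_at_top[of 0]
    proof eventually_elim
      case (elim \<beta>)
      have "(1 / \<beta>) *\<^sub>R (a k * complex_of_real (\<beta> powi (1 - int k))) = (1 / \<beta>) ^ k *\<^sub>R a k" for k
        using elim(2) by (simp add: power_int_diff scaleR_conv_of_real field_simps)
      with sums_scaleR_right[OF elim(1), of "1 / \<beta>"] show ?case by simp
    qed
    then show ?thesis
      by (rule quality_factor_decreases[where s = "\<lambda>\<beta>. 1 / \<beta>" and d = "b j"])
         (use a(1) b j eventually_gt_at_top[of "0::real"] in \<open>auto elim: eventually_mono\<close>)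
  qed

  have low_loss: "\<exists>a. a 0 = complex_of_real (\<rho> j) \<and>
      (\<forall>\<^sub>F \<beta> in at_top. (\<lambda>k. (1 / \<beta>) ^ k *\<^sub>R a k) sums \<zeta> j \<beta>)"
    and low_eig: "\<forall>\<^sub>F \<beta> in at_top. Omega_mat \<alpha> \<eta> \<theta> *v w j \<beta> - (\<i> * of_real \<beta>) *s (B_mat \<alpha> R *v w j \<beta>)
        = \<zeta> j \<beta> *s w j \<beta>"
    and low_nz: "\<forall>\<^sub>F \<beta> in at_top. w j \<beta> \<noteq> 0"
    if j: "j \<in> {rank R+1..2*CARD('n)}" for j
  proof -
    show "\<exists>a. a 0 = complex_of_real (\<rho> j) \<and>
      (\<forall>\<^sub>F \<beta> in at_top. (\<lambda>k. (1 / \<beta>) ^ k *\<^sub>R a k) sums \<zeta> j \<beta>)"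
      using low_ser[rule_format, OF j] by (simp add: scaleR_conv_of_real mult.commute)
    have j': "j \<in> {1..2*CARD('n)}" using j by simp
    show "\<forall>\<^sub>F \<beta> in at_top. Omega_mat \<alpha> \<eta> \<theta> *v w j \<beta> - (\<i> * of_real \<beta>) *s (B_mat \<alpha> R *v w j \<beta>)
        = \<zeta> j \<beta> *s w j \<beta>"
      using eig j' by (auto elim!: eventually_mono simp: A_mat_mult_vec)
    \<comment> \<open>An independent family does not contain \<open>0\<close>; the bound on
      \<open>Im\<close> requires a nonzero eigenvector.\<close>
    show "\<forall>\<^sub>F \<beta> in at_top. w j \<beta> \<noteq> 0"
      using eig
    proof eventually_elim
      case (elim \<beta>)
      with vec.dependent_zero[of "(\<lambda>j. w j \<beta>) ` {1..2*CARD('n)}"] j' show ?case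
        by (metis imageI)
    qed
  qed

  have "eventually_decreases_to (\<lambda>\<beta>. quality_factor (\<zeta> j \<beta>)) 0"
    if j: "j \<in> {rank R+1..2*rank R}" and \<rho>: "\<rho> j = 0" for j
  proof -
    have j': "j \<in> {rank R+1..2*CARD('n)}" "j \<in> {1..2*CARD('n)}" using j rank by auto
    obtain a where a: "a 0 = 0" "\<forall>\<^sub>F \<beta> in at_top. (\<lambda>k. (1 / \<beta>) ^ k *\<^sub>R a k) sums \<zeta> j \<beta>"
      using low_loss[OF j'(1)] \<rho> by auto
    obtain c where c: "c 0 = w0 j" "\<forall>\<^sub>F \<beta> in at_top. (\<lambda>k. (1 / \<beta>) ^ k *\<^sub>R c k) sums w j \<beta>"
      using w j'(2) by blast
    have "w0 j \<noteq> 0" using orth j'(2) by force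
    moreover have "B_mat \<alpha> R *v w0 j = 0" using low j'(1) by blast
    \<comment> \<open>As \<open>\<rho> j = 0\<close>, the coefficient \<open>a 1\<close> is the
      limit of \<open>\<beta>\<close> times the eigenvalue, to which the first-order dichotomy
      applies.\<close>
    ultimately have "(\<exists>d>0. a 1 = - \<i> * complex_of_real d) \<or> (\<forall>\<^sub>F \<beta> in at_top. \<zeta> j \<beta> = 0)"
      using powser_at_top_first_order[OF a(2)] powser_at_top_first_order[OF c(2)]
      by (intro dissipative_eigenvalue_first_order[OF herm gram low_eig[OF j'(1)]]) (simp_all add: a(1) c(1))
    then show ?thesis
    proof
      assume "\<exists>d>0. a 1 = - \<i> * complex_of_real d"
      then obtain d where d: "d > 0" "a 1 = - \<i> * complex_of_real d" by blast
      \<comment> \<open>Dropping the vanishing constant term and multiplying by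
        \<open>\<beta>\<close> moves \<open>a 1 = - \<i> d\<close> to index
        \<open>0\<close>.\<close>
      have "\<forall>\<^sub>F \<beta> in at_top. (\<lambda>k. (1 / \<beta>) ^ k *\<^sub>R a (Suc k)) sums (\<beta> *\<^sub>R \<zeta> j \<beta>)"
        using a(2) eventually_gt_at_top[of 0]
      proof eventually_elim
        case (elim \<beta>)
        have "(\<lambda>k. (1 / \<beta>) ^ Suc k *\<^sub>R a (Suc k)) sums \<zeta> j \<beta>"
          using elim(1) by (subst sums_Suc_iff) (simp add: a(1))
        from sums_scaleR_right[OF this, of \<beta>] show ?case using elim(2) by simp
      qed
      then show ?thesis
        by (rule quality_factor_decreases[where s = "\<lambda>\<beta>. \<beta>" and d = d])
           (use d in \<open>simp_all add: eventually_gt_at_top\<close>)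
    next
      assume "\<forall>\<^sub>F \<beta> in at_top. \<zeta> j \<beta> = 0"
      \<comment> \<open>The convention that \<open>quality_factor 0\<close> is \<open>0\<close>
        makes this branch eventually constant, hence decreasing in the non-strict sense.\<close>
      then have "\<forall>\<^sub>F \<beta> in at_top. quality_factor (\<zeta> j \<beta>) = 0"
        by eventually_elim (simp add: quality_factor_def)
      moreover have "eventually_decreases_to (\<lambda>_. 0) 0"
        by (auto simp: eventually_decreases_to_def monotone_on_def)
      ultimately show ?thesis by (rule eventually_decreases_to_cong)
    qed
  qed
  moreover have "eventually_increases_to (\<lambda>\<beta>. quality_factor (\<zeta> j \<beta>)) \<infinity>"
    if j: "j \<in> {2*rank R+1..2*CARD('n)}" and \<rho>: "\<rho> j \<noteq> 0" for j
  proof -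
    have j': "j \<in> {rank R+1..2*CARD('n)}" using j by auto
    obtain a where a: "a 0 = complex_of_real (\<rho> j)" "\<forall>\<^sub>F \<beta> in at_top. (\<lambda>k. (1 / \<beta>) ^ k *\<^sub>R a k) sums \<zeta> j \<beta>"
      using low_loss[OF j'] by blast
    \<comment> \<open>Dissipativity supplies the sign of \<open>Im\<close>, which the real leading
      coefficient \<open>\<rho> j\<close> leaves open.\<close>
    have "\<forall>\<^sub>F \<beta> in at_top. Im (\<zeta> j \<beta>) \<le> 0"
      using low_eig[OF j'] low_nz[OF j'] eventually_ge_at_top[of 0]
      by eventually_elim (rule dissipative_eigenvalue_Im_nonpos[OF herm gram])
    from quality_factor_increases[OF a(2) this a(1) \<rho>] show ?thesis .
  qed
  ultimately show ?thesis using high by blast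
qed

end
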